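(* Let $0<q<1$, $0<\alpha<1$ and $p>0$, and let $f$ be a function on $(0,\infty)$ such that the Jackson integrals involved in the definition of $D_{p,q}^{\alpha}J_{p,q}^{\alpha}f$ exist. Then, for $x>0$, $$(D_{p,q}^{\alpha}J_{p,q}^{\alpha}f)(x)=f(x).$$
   Context: Jackson integral: for $b>0$, $\int_0^b g(t)\,d_qt=(1-q)\,b\sum_{i=0}^{\infty}q^i g(q^i b)$; the integral exists when this series converges (for instance, if $|g(t)t^{\gamma}|$ is bounded on $(0,b]$ for some $0\le\gamma<1$). The $q$-derivative is $D_qg(x)=\frac{g(qx)-g(x)}{(q-1)x}$ for $x\neq0$. Notation: $(a;r)_\infty=\prod_{j=0}^{\infty}(1-r^j a)$ for $|r|<1$. For a real exponent $\alpha$ and $x>0$, $$(x-y)_{q^{p+1}}^{(\alpha)}=x^{\alpha}\prod_{k=0}^{\infty}\frac{x-y\,(q^{p+1})^{k}}{x-y\,(q^{p+1})^{k+\alpha}}=\frac{x^{\alpha}\left(\frac{y}{x};q^{p+1}\right)_\infty}{\left(q^{\alpha(p+1)}\frac{y}{x};q^{p+1}\right)_\infty}.$$ The $q$-fractional integral operator: for $\alpha>0$ and $x>0$, whenever the Jackson integral exists, $$J_{p,q}^{\alpha}f(x)=\frac{(1-q)^{\alpha-1}}{(1-q^{p+1})_{q^{p+1}}^{(\alpha-1)}}\int_0^{x}w^{p}f(w)\,\left(x^{p+1}-(wq)^{p+1}\right)_{q^{p+1}}^{(\alpha-1)}\,d_qw,$$ where $(1-q^{p+1})_{q^{p+1}}^{(\alpha-1)}$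 is the symbol above evaluated at first entry $1$ and second entry $q^{p+1}$. The generalized $q$-fractional derivative: for $\alpha>0$ and $n=\lfloor\alpha\rfloor+1$ (so $n=1$ when $0<\alpha<1$), $$(D_{p,q}^{\alpha}f)(x)=(x^{-p}D_q)^{n}\left(J_{p,q}^{n-\alpha}f\right)(x),$$ whenever the integral exists; here $x^{-p}D_q$ denotes the operator $g\mapsto x^{-p}D_qg(x)$. *)

theory Defs
  imports "HOL-Analysis.Infinite_Products"
begin

definition jackson_exists :: "real \<Rightarrow> real \<Rightarrow> (real \<Rightarrow> real) \<Rightarrow> bool" where
  "jackson_exists q b g \<longleftrightarrow> summable (\<lambda>i. q ^ i * g (q ^ i * b))"

definition jackson_integral :: "real \<Rightarrow> real \<Rightarrow> (real \<Rightarrow> real) \<Rightarrow> real" where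
  "jackson_integral q b g = (1 - q) * b * (\<Sum>i. q ^ i * g (q ^ i * b))"

definition q_derivative :: "real \<Rightarrow> (real \<Rightarrow> real) \<Rightarrow> real \<Rightarrow> real" where
  "q_derivative q g x = (g (q * x) - g x) / ((q - 1) * x)"

(* q_power r a x y is the symbol (x - y)_r^(a), with base r; the operators below
   use it with r = q powr (p + 1). *)
definition q_power :: "real \<Rightarrow> real \<Rightarrow> real \<Rightarrow> real \<Rightarrow> real" where
  "q_power r a x y =
     x powr a * prodinf (\<lambda>k::nat. (x - y * r ^ k) / (x - y * r powr (real k + a)))"

definition qfrac_integrand ::
  "real \<Rightarrow> real \<Rightarrow> real \<Rightarrow> (real \<Rightarrow> real) \<Rightarrow> real \<Rightarrow> real \<Rightarrow> real" where
  "qfrac_integrand p q \<alpha> f x w =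
     w powr p * f w * q_power (q powr (p + 1)) (\<alpha> - 1) (x powr (p + 1)) ((w * q) powr (p + 1))"

definition qfrac_integral_exists ::
  "real \<Rightarrow> real \<Rightarrow> real \<Rightarrow> (real \<Rightarrow> real) \<Rightarrow> real \<Rightarrow> bool" where
  "qfrac_integral_exists p q \<alpha> f x \<longleftrightarrow> jackson_exists q x (qfrac_integrand p q \<alpha> f x)"

(* Meaningful only where qfrac_integral_exists holds; a divergent series leaves an
   unspecified value. *)
definition qfrac_integral ::
  "real \<Rightarrow> real \<Rightarrow> real \<Rightarrow> (real \<Rightarrow> real) \<Rightarrow> real \<Rightarrow> real" where
  "qfrac_integral p q \<alpha> f x =
     (1 - q) powr (\<alpha> - 1) / q_power (q powr (p + 1)) (\<alpha> - 1) 1 (q powr (p + 1))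
       * jackson_integral q x (qfrac_integrand p q \<alpha> f x)"

definition qfrac_order :: "real \<Rightarrow> nat" where
  "qfrac_order \<alpha> = nat \<lfloor>\<alpha>\<rfloor> + 1"

definition qfrac_derivative ::
  "real \<Rightarrow> real \<Rightarrow> real \<Rightarrow> (real \<Rightarrow> real) \<Rightarrow> real \<Rightarrow> real" where
  "qfrac_derivative p q \<alpha> f =
     ((\<lambda>g x. x powr (- p) * q_derivative q g x) ^^ qfrac_order \<alpha>)
       (qfrac_integral p q (real (qfrac_order \<alpha>) - \<alpha>) f)"

end

theory Submission
  imports Defs "HOL-Analysis.Infinite_Sum" "HOL-Computational_Algebra.Formal_Power_Series"
begin

text \<open>Put \<open>r = q powr (p + 1)\<close>, \<open>X = x powr (p + 1)\<close> and \<open>c\<^sub>a(n) = (r\<^sup>a; r)\<^sub>n / (r; r)\<^sub>n\<close>.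
  On the lattice \<open>q ^ i * x\<close> the kernel is a multiple of \<open>c\<^sub>a(i)\<close>, so the fractional integral of
  order \<open>a\<close> at \<open>x\<close> is \<open>(1 - q)\<^sup>a X\<^sup>a \<Sum>\<^sub>i c\<^sub>a(i) r\<^sup>i f(q\<^sup>i x)\<close>. Composing the orders \<open>\<alpha>\<close> and
  \<open>1 - \<alpha>\<close> gives a double series along whose diagonals the coefficients sum to
  \<open>\<Sum>\<^sub>i r\<^sup>i\<^sup>\<alpha> c\<^sub>1\<^sub>-\<^sub>\<alpha>(i) c\<^sub>\<alpha>(n - i) = 1\<close>, a case of the q-Vandermonde identity. What remains is
  \<open>(1 - q) X \<Sum>\<^sub>n r\<^sup>n f(q\<^sup>n x)\<close>, whose q-difference telescopes.\<close>

section \<open>The q-Vandermonde identity\<close>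

text \<open>These are the coefficients \<open>(A; r)_n / (r; r)_n\<close> of the q-binomial series,
  whose sum is (A z; r)_inf / (z; r)_inf.\<close>

definition q_binom :: "real \<Rightarrow> real \<Rightarrow> nat \<Rightarrow> real" where
  "q_binom r A n = (\<Prod>k<n. (1 - A * r ^ k) / (1 - r ^ (k + 1)))"

lemma q_binom_0 [simp]: "q_binom r A 0 = 1"
  by (simp add: q_binom_def)

lemma q_binom_Suc:
  assumes "0 < r" "r < 1"
  shows "(1 - r ^ Suc n) * q_binom r A (Suc n) = (1 - A * r ^ n) * q_binom r A n"
proof -
  have "r ^ Suc n < 1" using assms by (intro power_Suc_less_one) auto
  then show ?thesis by (simp add: q_binom_def)
qed

text \<open>The substitution of c z for z. It lets q-difference equations be stated for formal power
  series, with no question of convergence.\<close>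

definition fps_scale :: "real \<Rightarrow> real fps \<Rightarrow> real fps" where
  "fps_scale c f = Abs_fps (\<lambda>n. c ^ n * fps_nth f n)"

lemma fps_scale_nth [simp]: "fps_nth (fps_scale c f) n = c ^ n * fps_nth f n"
  by (simp add: fps_scale_def)

lemma fps_scale_mult: "fps_scale c (f * g) = fps_scale c f * fps_scale c g"
proof (rule fps_ext)
  fix n
  have "c ^ n * (\<Sum>i=0..n. fps_nth f i * fps_nth g (n - i)) =
      (\<Sum>i=0..n. (c ^ i * fps_nth f i) * (c ^ (n - i) * fps_nth g (n - i)))"
    unfolding sum_distrib_left
  proof (rule sum.cong)
    fix i assume "i \<in> {0..n}"
    then have "c ^ n = c ^ i * c ^ (n - i)" by (simp flip: power_add)
    then show "c ^ n * (fps_nth f i * fps_nth g (n - i)) =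
        (c ^ i * fps_nth f i) * (c ^ (n - i) * fps_nth g (n - i))" by simp
  qed simp
  then show "fps_nth (fps_scale c (f * g)) n = fps_nth (fps_scale c f * fps_scale c g) n"
    by (simp add: fps_mult_nth)
qed

text \<open>Comparing coefficients of z^(n+1) turns the equation into the recurrence
  \<open>q_binom_Suc\<close>. Its leading factor \<open>1 - r ^ Suc n\<close> is nonzero, so the
  constant term determines the whole series.\<close>

lemma fps_eq_if_scale_functional_equation:
  assumes r: "0 < r" "r < 1"
    and f: "(1 - fps_X) * f = (1 - fps_const B * fps_X) * fps_scale r f"
    and f0: "fps_nth f 0 = 1"
  shows "fps_nth f n = q_binom r B n"
proof (induction n)
  case (Suc n)
  have "fps_nth f (Suc n) - fps_nth f n =
      r ^ Suc n * fps_nth f (Suc n) - B * (r ^ n * fps_nth f n)"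
    using arg_cong[OF f, of "\<lambda>h. fps_nth h (Suc n)"]
    by (simp add: left_diff_distrib mult.assoc)
  then have "(1 - r ^ Suc n) * fps_nth f (Suc n) = (1 - r ^ Suc n) * q_binom r B (Suc n)"
    unfolding q_binom_Suc[OF r] using Suc by (simp add: algebra_simps)
  moreover have "r ^ Suc n < 1" using r by (intro power_Suc_less_one) auto
  ultimately show ?case by simp
qed (simp add: f0)

lemma q_binom_functional_equation:
  assumes r: "0 < r" "r < 1"
  defines "F \<equiv> \<lambda>A. Abs_fps (q_binom r A)"
  shows "(1 - fps_X) * F A = (1 - fps_const A * fps_X) * fps_scale r (F A)"
proof (rule fps_ext)
  fix n
  show "fps_nth ((1 - fps_X) * F A) n =
      fps_nth ((1 - fps_const A * fps_X) * fps_scale r (F A)) n"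
  proof (cases n)
    case (Suc m)
    then show ?thesis using q_binom_Suc[OF r, of m A]
      by (simp add: F_def left_diff_distrib mult.assoc)
  qed (simp add: F_def)
qed

text \<open>Write F_A(z) for the series with coefficients \<open>q_binom r A\<close>. Formally
  F_A(z) = (A z; r)_inf / (z; r)_inf, so F_A(z) F_B(A z) = F_AB(z), and the sum is a coefficient of
  the left side. Instead of infinite products, the proof uses the functional equation that
  characterises F_AB.\<close>

lemma q_Vandermonde:
  assumes r: "0 < r" "r < 1"
  shows "(\<Sum>i\<le>n. A ^ i * q_binom r B i * q_binom r A (n - i)) = q_binom r (A * B) n"
proof -
  define F where "F = (\<lambda>A. Abs_fps (q_binom r A))"
  define H where "H = F A * fps_scale A (F B)"
  have scale_linear: "fps_scale c (1 - fps_const b * fps_X) = 1 - fps_const (c * b) * fps_X" for c b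
    by (rule fps_ext) (auto simp: fps_X_def)
  have "fps_scale A ((1 - fps_X) * F B) = fps_scale A ((1 - fps_const B * fps_X) * fps_scale r (F B))"
    using q_binom_functional_equation[OF r] by (simp add: F_def)
  then have FB: "(1 - fps_const A * fps_X) * fps_scale A (F B) =
      (1 - fps_const (A * B) * fps_X) * fps_scale r (fps_scale A (F B))"
    using scale_linear[of A 1]
    by (simp add: fps_scale_mult scale_linear) (simp add: fps_scale_def mult.left_commute)
  have FA: "(1 - fps_X) * F A = (1 - fps_const A * fps_X) * fps_scale r (F A)"
    using q_binom_functional_equation[OF r] by (simp add: F_def)
  \<comment> \<open>The factor 1 - A z stands on the right of \<open>FA\<close> and on the left of
    \<open>FB\<close>. Multiplying the two equations and cancelling it leaves the functional
    equation with parameter \<open>A * B\<close>.\<close>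
  have "(1 - fps_const A * fps_X) * ((1 - fps_X) * H) =
      ((1 - fps_X) * F A) * ((1 - fps_const A * fps_X) * fps_scale A (F B))"
    by (simp add: H_def mult_ac)
  also have "\<dots> = (1 - fps_const A * fps_X) * ((1 - fps_const (A * B) * fps_X) * fps_scale r H)"
    unfolding FA FB by (simp add: H_def fps_scale_mult mult_ac)
  finally have "(1 - fps_const A * fps_X) * ((1 - fps_X) * H) =
      (1 - fps_const A * fps_X) * ((1 - fps_const (A * B) * fps_X) * fps_scale r H)" .
  moreover have "1 - fps_const A * fps_X \<noteq> 0"
    by (metis fps_nonzeroI fps_mult_nth_0 fps_sub_nth fps_X_nth fps_one_nth
        diff_zero mult_zero_right zero_neq_one)
  ultimately have "(1 - fps_X) * H = (1 - fps_const (A * B) * fps_X) * fps_scale r H"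
    by simp
  moreover have "fps_nth H 0 = 1" by (simp add: H_def F_def)
  ultimately have "fps_nth H n = q_binom r (A * B) n"
    by (intro fps_eq_if_scale_functional_equation[OF r])
  moreover have "fps_nth H n = (\<Sum>i\<le>n. A ^ i * q_binom r B i * q_binom r A (n - i))"
    unfolding H_def F_def by (subst mult.commute) (simp add: fps_mult_nth atLeast0AtMost)
  ultimately show ?thesis by simp
qed

lemma q_binom_self:
  assumes "0 < r" "r < 1"
  shows "q_binom r r n = 1"
proof -
  have "r * r ^ k \<noteq> 1" for k
    using power_Suc_less_one[OF assms, of k] by simp
  then show ?thesis by (simp add: q_binom_def)
qed

section \<open>Inverting a convolution on conditionally convergent series\<close>

text \<open>Abel summation against the tails \<open>U\<close> of the series, based on u n = U n - U
  (n + 1). Only \<open>e\<close> has to be absolutely summable; \<open>u\<close> may converge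
  conditionally.\<close>

lemma summation_by_parts:
  fixes e u :: "nat \<Rightarrow> real"
  assumes e: "summable (\<lambda>n. \<bar>e n\<bar>)" and u: "summable u"
  defines "U \<equiv> \<lambda>n. \<Sum>k. u (n + k)"
  shows "(\<lambda>n. (\<Sum>k\<le>n. e k) * u n) sums (\<Sum>n. e n * U n)"
    and "\<exists>M. \<forall>n. \<bar>U n\<bar> \<le> M"
proof -
  have U_eq: "U n = suminf u - (\<Sum>k<n. u k)" for n
    using suminf_minus_initial_segment[OF u, of n] by (simp add: U_def add.commute)
  have u_eq: "u n = U n - U (Suc n)" for n by (simp add: U_eq)
  have U0: "U \<longlonglongrightarrow> 0"
    unfolding U_eq using tendsto_diff[OF tendsto_const summable_LIMSEQ[OF u], of "suminf u"] by simp
  then have "Bseq U" by (intro convergent_imp_Bseq) (auto simp: convergent_def)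
  then obtain M where M: "\<bar>U n\<bar> \<le> M" for n unfolding Bseq_def by auto
  then show "\<exists>M. \<forall>n. \<bar>U n\<bar> \<le> M" by blast
  have "summable (\<lambda>n. e n * U n)"
  proof (rule summable_comparison_test')
    show "summable (\<lambda>n. \<bar>e n\<bar> * M)" using e by (rule summable_mult2)
    show "norm (e n * U n) \<le> \<bar>e n\<bar> * M" for n
      using M[of n] by (simp add: abs_mult mult_left_mono)
  qed
  then have "(\<lambda>n. \<Sum>k<Suc n. e k * U k) \<longlonglongrightarrow> (\<Sum>n. e n * U n)"
    by (intro LIMSEQ_Suc summable_LIMSEQ)
  moreover have "(\<lambda>n. \<Sum>k<Suc n. e k) \<longlonglongrightarrow> suminf e"
    using e by (intro LIMSEQ_Suc summable_LIMSEQ) (rule summable_rabs_cancel)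
  \<comment> \<open>The subtracted boundary term vanishes in the limit: the partial sums of
    \<open>e\<close> converge and the tails tend to 0.\<close>
  ultimately have "(\<lambda>n. (\<Sum>k<Suc n. e k * U k) - (\<Sum>k<Suc n. e k) * U (Suc n))
      \<longlonglongrightarrow> (\<Sum>n. e n * U n) - suminf e * 0"
    by (intro tendsto_diff tendsto_mult LIMSEQ_Suc[OF U0])
  moreover have "(\<Sum>k<Suc n. e k * U k) - (\<Sum>k<Suc n. e k) * U (Suc n) =
      (\<Sum>m<Suc n. (\<Sum>k\<le>m. e k) * u m)" for n
    by (induction n) (simp_all add: u_eq lessThan_Suc_atMost algebra_simps)
  ultimately have "(\<lambda>n. \<Sum>m<Suc n. (\<Sum>k\<le>m. e k) * u m) \<longlonglongrightarrow> (\<Sum>n. e n * U n)"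
    by simp
  then show "(\<lambda>n. (\<Sum>k\<le>n. e k) * u n) sums (\<Sum>n. e n * U n)"
    unfolding sums_def by (subst (asm) filterlim_sequentially_Suc)
qed

lemma infsum_eq_suminf:
  fixes f :: "nat \<Rightarrow> real"
  shows "f summable_on UNIV \<Longrightarrow> infsum f UNIV = suminf f"
  by (intro sums_unique has_sum_imp_sums has_sum_infsum)

text \<open>The double family is dominated by M |d i| |e j|, hence summable over all pairs. Summing
  it by rows gives the left side, by diagonals i + j = n the right side.\<close>

lemma suminf_convolution_shift:
  fixes d e G :: "nat \<Rightarrow> real"
  assumes d: "summable (\<lambda>n. \<bar>d n\<bar>)" and e: "summable (\<lambda>n. \<bar>e n\<bar>)"
    and G: "\<And>n. \<bar>G n\<bar> \<le> M"
  shows "(\<Sum>i. d i * (\<Sum>j. e j * G (i + j))) = (\<Sum>n. (\<Sum>i\<le>n. d i * e (n - i)) * G n)"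
proof -
  define h where "h = (\<lambda>(i, j). d i * e j * G (i + j))"
  define g where "g = (\<lambda>(n::nat, i). (i, n - i))"
  have de: "(\<lambda>(i, j). \<bar>d i\<bar> * \<bar>e j\<bar>) summable_on UNIV \<times> UNIV"
    using d e by (intro summable_on_SigmaI[where g = "\<lambda>i. \<bar>d i\<bar> * (\<Sum>j. \<bar>e j\<bar>)"])
      (auto intro!: has_sum_cmult_right sums_nonneg_imp_has_sum summable_sums
        summable_on_cmult_left simp: summable_on_UNIV_nonneg_real_iff)
  have h: "h summable_on UNIV \<times> UNIV"
  proof (rule abs_summable_summable, rule summable_on_comparison_test)
    show "(\<lambda>x. (case x of (i, j) \<Rightarrow> \<bar>d i\<bar> * \<bar>e j\<bar>) * M) summable_on UNIV \<times> UNIV"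
      using de by (rule summable_on_cmult_left)
    show "norm (h x) \<le> (case x of (i, j) \<Rightarrow> \<bar>d i\<bar> * \<bar>e j\<bar>) * M" for x
      using G by (auto simp: h_def abs_mult intro!: mult_left_mono split: prod.split)
  qed auto
  have inner: "summable (\<lambda>j. \<bar>e j * G (i + j)\<bar>)" for i
  proof (rule summable_comparison_test')
    show "summable (\<lambda>n. \<bar>e n\<bar> * M)" using e by (rule summable_mult2)
    show "norm \<bar>e j * G (i + j)\<bar> \<le> \<bar>e j\<bar> * M" for j
      using G[of "i + j"] by (simp add: abs_mult mult_left_mono)
  qed
  have row: "infsum (\<lambda>j. h (i, j)) UNIV = d i * (\<Sum>j. e j * G (i + j))" for i
  proof -
    have "((\<lambda>j. e j * G (i + j)) has_sum (\<Sum>j. e j * G (i + j))) UNIV"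
      using inner[of i] by (intro norm_summable_imp_has_sum summable_sums)
        (auto intro: summable_rabs_cancel)
    from has_sum_cmult_right[OF this, of "d i"] show ?thesis
      by (intro infsumI) (simp add: h_def mult.assoc)
  qed
  have "infsum h (UNIV \<times> UNIV) = infsum (\<lambda>i. infsum (\<lambda>j. h (i, j)) UNIV) UNIV"
    using infsum_Sigma_banach[OF h] by simp
  also have "\<dots> = (\<Sum>i. d i * (\<Sum>j. e j * G (i + j)))"
    using summable_on_Sigma_banach[of "\<lambda>i j. h (i, j)" UNIV "\<lambda>_. UNIV"] h
    by (simp add: row infsum_eq_suminf)
  finally have 1: "infsum h (UNIV \<times> UNIV) = (\<Sum>i. d i * (\<Sum>j. e j * G (i + j)))" .
  \<comment> \<open>\<open>g\<close> lists the pairs by diagonals: (n, i) goes to the i-th pair with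
    sum n.\<close>
  have g: "bij_betw g (SIGMA n:UNIV. {..n}) (UNIV \<times> UNIV)"
    by (rule bij_betwI[where g = "\<lambda>(i, j). (i + j, i)"]) (auto simp: g_def)
  have hg: "(\<lambda>x. h (g x)) summable_on (SIGMA n:UNIV. {..n})"
    using h summable_on_reindex_bij_betw[OF g] by blast
  have diag: "infsum (\<lambda>i. h (g (n, i))) {..n} = (\<Sum>i\<le>n. d i * e (n - i)) * G n" for n
    by (auto simp: g_def h_def sum_distrib_right intro!: sum.cong)
  have "infsum h (UNIV \<times> UNIV) = infsum (\<lambda>x. h (g x)) (SIGMA n:UNIV. {..n})"
    by (rule infsum_reindex_bij_betw[OF g, symmetric])
  also have "\<dots> = infsum (\<lambda>n. infsum (\<lambda>i. h (g (n, i))) {..n}) UNIV"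
    using infsum_Sigma_banach[OF hg] by simp
  also have "\<dots> = (\<Sum>n. (\<Sum>i\<le>n. d i * e (n - i)) * G n)"
  proof -
    have "(\<lambda>x. h (g x)) = (\<lambda>(n, i). h (g (n, i)))" by (rule ext) (auto split: prod.split)
    then have "(\<lambda>n. infsum (\<lambda>i. h (g (n, i))) {..n}) summable_on UNIV"
      using summable_on_Sigma_banach[of "\<lambda>n i. h (g (n, i))" UNIV "\<lambda>n. {..n}"] hg by metis
    then show ?thesis unfolding diag by (rule infsum_eq_suminf)
  qed
  finally show ?thesis using 1 by simp
qed

text \<open>The series \<open>u\<close> may converge only conditionally, so the order of summation cannot be
  exchanged directly: summation by parts first replaces \<open>u\<close> by its bounded tails and \<open>c\<close>
  by its absolutely summable differences.\<close>

lemma suminf_convolution_inverse: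
  fixes c d u :: "nat \<Rightarrow> real"
  assumes d: "summable (\<lambda>n. \<bar>d n\<bar>)" and c: "summable (\<lambda>n. \<bar>c (Suc n) - c n\<bar>)"
    and u: "summable u" and dc: "\<And>n. (\<Sum>i\<le>n. d i * c (n - i)) = 1"
  shows "(\<Sum>i. d i * (\<Sum>j. c j * u (i + j))) = suminf u"
proof -
  \<comment> \<open>The value \<open>c 0\<close> at index 0 makes the partial sums of the
    differences equal to \<open>c\<close> itself.\<close>
  define e where "e = (\<lambda>n. case n of 0 \<Rightarrow> c 0 | Suc m \<Rightarrow> c (Suc m) - c m)"
  define U where "U = (\<lambda>n. \<Sum>k. u (n + k))"
  have e: "summable (\<lambda>n. \<bar>e n\<bar>)"
    using c by (subst summable_Suc_iff[symmetric]) (simp add: e_def)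
  have c_eq: "c n = (\<Sum>k\<le>n. e k)" for n
    by (induction n) (simp_all add: e_def)
  obtain M where M: "\<bar>U n\<bar> \<le> M" for n
    using summation_by_parts(2)[OF e u] unfolding U_def by blast
  have "(\<Sum>j. c j * u (i + j)) = (\<Sum>j. e j * U (i + j))" for i
  proof -
    have "summable (\<lambda>j. u (i + j))"
      using u by (simp add: add.commute[of i])
    from summation_by_parts(1)[OF e this] show ?thesis
      by (simp add: sums_iff c_eq U_def add.assoc)
  qed
  then have "(\<Sum>i. d i * (\<Sum>j. c j * u (i + j))) = (\<Sum>i. d i * (\<Sum>j. e j * U (i + j)))"
    by simp
  also have "\<dots> = (\<Sum>n. (\<Sum>i\<le>n. d i * e (n - i)) * U n)"
    by (rule suminf_convolution_shift[OF d e M])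
  \<comment> \<open>For n > 0 the diagonal sum with \<open>e\<close> is the difference of two
    consecutive diagonal sums with \<open>c\<close>, that is 1 - 1. Only n = 0 survives.\<close>
  also have "\<dots> = (\<Sum>n. if n = 0 then U 0 else 0)"
  proof (rule suminf_cong)
    fix n
    show "(\<Sum>i\<le>n. d i * e (n - i)) * U n = (if n = 0 then U 0 else 0)"
    proof (cases n)
      case 0
      then show ?thesis using dc[of 0] by (simp add: e_def)
    next
      case (Suc m)
      have "(\<Sum>i\<le>m. d i * e (Suc m - i)) = (\<Sum>i\<le>m. d i * c (Suc m - i) - d i * c (m - i))"
        by (intro sum.cong) (simp_all add: e_def Suc_diff_le right_diff_distrib)
      \<comment> \<open>The last index i = Suc m contributes d i times \<open>e 0 = c 0\<close>;
        this is why the second sum stops at m.\<close>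
      then have "(\<Sum>i\<le>Suc m. d i * e (Suc m - i)) =
          (\<Sum>i\<le>Suc m. d i * c (Suc m - i)) - (\<Sum>i\<le>m. d i * c (m - i))"
        by (simp add: sum_subtractf e_def)
      then show ?thesis using Suc dc by simp
    qed
  qed
  also have "\<dots> = U 0" by (rule sums_unique[symmetric, OF sums_single])
  finally show ?thesis by (simp add: U_def)
qed

section \<open>The q-power kernel on a geometric lattice\<close>

lemma summable_abs_diff_if_decseq:
  fixes b :: "nat \<Rightarrow> real"
  assumes "decseq b" "\<And>n. L \<le> b n"
  shows "summable (\<lambda>n. \<bar>b (Suc n) - b n\<bar>)"
proof -
  obtain l where "b \<longlonglongrightarrow> l" using decseq_convergent[of b L] assms by blast
  from telescope_summable'[OF this] show ?thesis
    using assms(1) by (simp add: decseq_Suc_iff abs_of_nonpos)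
qed

context
  fixes r A :: real
  assumes r: "0 < r" "r < 1" and A: "r < A" "A < 1"
begin

text \<open>From r < A follows r^(k+1) < A r^k, so the numerator stays below the denominator; both
  are positive because A < 1. The range of \<open>A\<close> is that of r^a with 0 < a < 1.\<close>

lemma q_binom_factor: "0 < (1 - A * r ^ k) / (1 - r ^ (k + 1))"
    "(1 - A * r ^ k) / (1 - r ^ (k + 1)) \<le> 1"
proof -
  have "r ^ (k + 1) < 1" using r by (metis power_Suc_less_one Suc_eq_plus1)
  moreover have "A * r ^ k \<le> A"
    using mult_left_le[of "r ^ k" A] r A by (simp add: power_le_one)
  moreover have "r ^ (k + 1) \<le> A * r ^ k" using r A by simp
  ultimately show "0 < (1 - A * r ^ k) / (1 - r ^ (k + 1))"
    "(1 - A * r ^ k) / (1 - r ^ (k + 1)) \<le> 1"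
    using A by (auto simp: divide_simps)
qed

lemma q_binom_pos: "0 < q_binom r A n"
  unfolding q_binom_def using q_binom_factor by (intro prod_pos) blast

lemma q_binom_le_1: "q_binom r A n \<le> 1"
  unfolding q_binom_def using q_binom_factor by (intro prod_le_1) (auto intro: less_imp_le)

lemma decseq_q_binom: "decseq (q_binom r A)"
proof (rule decseq_SucI)
  fix n
  show "q_binom r A (Suc n) \<le> q_binom r A n"
    using mult_left_le[OF q_binom_factor(2)[of n] less_imp_le[OF q_binom_pos[of n]]]
    by (simp add: q_binom_def)
qed

text \<open>The k-th factor exceeds 1 by (A - r) r^k / (1 - A r^k), which a geometric sequence
  dominates.\<close>

lemma convergent_prod_inverse_q_binom_factor:
  "convergent_prod (\<lambda>k. (1 - r ^ (k + 1)) / (1 - A * r ^ k))"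
proof (rule abs_convergent_prod_imp_convergent_prod, rule summable_imp_abs_convergent_prod,
    rule summable_comparison_test')
  show "summable (\<lambda>k. (A - r) / (1 - A) * r ^ k)"
    using r by (intro summable_mult summable_geometric) simp
  fix k
  have *: "A * r ^ k \<le> A"
    using mult_left_le[of "r ^ k" A] r A by (simp add: power_le_one)
  then have lt: "A * r ^ k < 1" using A by linarith
  then have "(1 - r ^ (k + 1)) / (1 - A * r ^ k) - 1 = (A - r) * r ^ k / (1 - A * r ^ k)"
    by (simp add: field_simps)
  moreover have "(A - r) * r ^ k / (1 - A * r ^ k) \<le> (A - r) * r ^ k / (1 - A)"
    using * lt r A by (intro divide_left_mono mult_pos_pos mult_nonneg_nonneg) auto
  moreover have "0 \<le> (A - r) * r ^ k / (1 - A * r ^ k)"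
    using lt r A by (intro divide_nonneg_nonneg mult_nonneg_nonneg) auto
  ultimately have "\<bar>(1 - r ^ (k + 1)) / (1 - A * r ^ k) - 1\<bar> \<le> (A - r) / (1 - A) * r ^ k"
    by (metis abs_of_nonneg times_divide_eq_left)
  then show "norm (norm ((1 - r ^ (k + 1)) / (1 - A * r ^ k) - 1)) \<le> (A - r) / (1 - A) * r ^ k"
    by simp
qed

lemma inverse_q_binom: "(\<Prod>k<n. (1 - r ^ (k + 1)) / (1 - A * r ^ k)) = inverse (q_binom r A n)"
  unfolding q_binom_def prod_inversef[symmetric] by (simp add: inverse_eq_divide)

lemma inverse_q_binom_factor_pos: "0 < (1 - r ^ (k + 1)) / (1 - A * r ^ k)"
  using q_binom_factor(1)[of k] unfolding zero_less_divide_iff by auto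

text \<open>Abel's test: the reciprocals of \<open>q_binom r A\<close> increase to a finite limit,
  so their differences are absolutely summable and multiplication by them preserves convergence.
  Existence of a fractional integral thus gives convergence of the series without kernel
  weights.\<close>

lemma summable_cancel_q_binom:
  assumes "summable (\<lambda>n. q_binom r A n * u n)"
  shows "summable u"
proof -
  define b where "b = (\<lambda>n. inverse (q_binom r A n))"
  have "(\<lambda>n. \<Prod>k\<le>n. (1 - r ^ (k + 1)) / (1 - A * r ^ k))
      \<longlonglongrightarrow> (\<Prod>k. (1 - r ^ (k + 1)) / (1 - A * r ^ k))"
    by (rule convergent_prod_LIMSEQ[OF convergent_prod_inverse_q_binom_factor])
  then have "b \<longlonglongrightarrow> (\<Prod>k. (1 - r ^ (k + 1)) / (1 - A * r ^ k))"
    unfolding b_def inverse_q_binom[symmetric] by (simp add: LIMSEQ_lessThan_iff_atMost)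
  then have "summable (\<lambda>n. b (Suc n) - b n)" by (rule telescope_summable)
  moreover have "b n \<le> b (Suc n)" for n
    using decseq_q_binom q_binom_pos by (simp add: b_def decseq_Suc_iff)
  ultimately have "summable (\<lambda>n. \<bar>b (Suc n) - b n\<bar>)" by simp
  then have e: "summable (\<lambda>n. \<bar>case n of 0 \<Rightarrow> b 0 | Suc m \<Rightarrow> b (Suc m) - b m\<bar>)"
    by (subst summable_Suc_iff[symmetric]) simp
  have "(\<Sum>k\<le>n. case k of 0 \<Rightarrow> b 0 | Suc m \<Rightarrow> b (Suc m) - b m) = b n" for n
    by (induction n) simp_all
  then have "summable (\<lambda>n. b n * (q_binom r A n * u n))"
    using summation_by_parts(1)[OF e assms] by (simp add: sums_iff)
  moreover have "b n * (q_binom r A n * u n) = u n" for n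
    using q_binom_pos[of n] by (simp add: b_def)
  ultimately show ?thesis by simp
qed

end

lemma powr_between_if_exponent_less_1:
  fixes r a :: real
  assumes "0 < r" "r < 1" "0 < a" "a < 1"
  shows "r < r powr a" "r powr a < 1"
  using assms powr_less_mono'[of r a 1] powr_less_mono'[of r 0 a] by auto

text \<open>At the second entry X r^(i+1) the k-th factor of the kernel is \<open>F (k + i)\<close>,
  so the product is that of the normalising constant without its first i factors. The missing
  factors multiply to \<open>inverse (q_binom r (r powr a) i)\<close>.\<close>

lemma q_power_lattice:
  fixes r a X :: real
  assumes r: "0 < r" "r < 1" and a: "0 < a" "a < 1" and X: "0 < X"
  shows "q_power r (a - 1) X (X * r ^ (i + 1)) =
      X powr (a - 1) * q_power r (a - 1) 1 r * q_binom r (r powr a) i"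
    and "0 < q_power r (a - 1) 1 r"
proof -
  define F where "F = (\<lambda>k. (1 - r ^ (k + 1)) / (1 - r powr a * r ^ k))"
  note A = powr_between_if_exponent_less_1[OF r a]
  have conv: "convergent_prod F"
    unfolding F_def by (rule convergent_prod_inverse_q_binom_factor[OF r A])
  have Fpos: "0 < F k" for k
    unfolding F_def by (rule inverse_q_binom_factor_pos[OF r A])
  have pow: "r ^ (i + 1) * r powr (real k + (a - 1)) = r powr a * r ^ (k + i)" for i k
  proof -
    have "r ^ (i + 1) * r powr (real k + (a - 1)) = r powr (real (i + 1) + (real k + (a - 1)))"
      using r by (simp only: powr_realpow[symmetric] powr_add)
    also have "real (i + 1) + (real k + (a - 1)) = a + real (k + i)" by simp
    also have "r powr \<dots> = r powr a * r ^ (k + i)"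
      using r by (simp only: powr_realpow[symmetric] powr_add)
    finally show ?thesis .
  qed
  have shift: "q_power r (a - 1) X (X * r ^ (i + 1)) = X powr (a - 1) * (\<Prod>k. F (k + i))"
    if "0 < X" for X i
  proof -
    have "(X - X * r ^ (i + 1) * r ^ k) / (X - X * r ^ (i + 1) * r powr (real k + (a - 1))) = F (k + i)" for k
    proof -
      have "X - X * r ^ (i + 1) * r ^ k = X * (1 - r ^ (k + i + 1))"
        by (simp add: algebra_simps power_add)
      moreover have "X - X * r ^ (i + 1) * r powr (real k + (a - 1)) = X * (1 - r powr a * r ^ (k + i))"
        using pow[of i k] by (simp only: mult.assoc) (simp add: algebra_simps)
      ultimately show ?thesis using that by (simp add: F_def)
    qed
    then show ?thesis by (simp only: q_power_def)
  qed
  have base: "q_power r (a - 1) 1 r = prodinf F"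
    using shift[of 1 0] by simp
  show "0 < q_power r (a - 1) 1 r"
    unfolding base by (rule less_0_prodinf[OF conv Fpos])
  have "(\<Prod>k. F (k + i)) = prodinf F / (\<Prod>k<i. F k)"
    using Fpos by (intro prodinf_divide_initial_segment[OF conv]) (metis less_irrefl)
  then show "q_power r (a - 1) X (X * r ^ (i + 1)) =
      X powr (a - 1) * q_power r (a - 1) 1 r * q_binom r (r powr a) i"
    unfolding shift[OF X] base F_def inverse_q_binom[OF r A] by (simp add: divide_inverse)
qed

section \<open>Fractional integrals as series\<close>

lemma base_powr:
  fixes p q :: real
  assumes "0 < q" "q < 1" "0 < p"
  shows "0 < q powr (p + 1)" "q powr (p + 1) < 1"
  using assms powr_less_mono'[of q 0 "p + 1"] by auto

lemma powr_lattice: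
  fixes p q x :: real
  assumes "0 < q" "0 < x"
  shows "(q ^ i * x) powr (p + 1) = (q powr (p + 1)) ^ i * x powr (p + 1)"
  using assms by (simp add: powr_mult powr_powr powr_realpow[symmetric] mult.commute)

text \<open>The leading \<open>x\<close> is the one in front of the Jackson sum. With X = x^(p+1),
  it combines with q^i and w^p to r^i X, and this X joins the kernel's X^(a-1) to give X^a.\<close>

lemma qfrac_integrand_lattice:
  fixes p q a x :: real
  assumes q: "0 < q" "q < 1" and p: "0 < p" and a: "0 < a" "a < 1" and x: "0 < x"
  defines "r \<equiv> q powr (p + 1)"
  shows "x * (q ^ i * qfrac_integrand p q a f x (q ^ i * x)) =
      (x powr (p + 1)) powr a * q_power r (a - 1) 1 r *
        (q_binom r (r powr a) i * (r ^ i * f (q ^ i * x)))"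
proof -
  define X where "X = x powr (p + 1)"
  have X: "0 < X" using x by (simp add: X_def)
  note r = base_powr[OF q p, folded r_def]
  have "q ^ i * x * q = q ^ (i + 1) * x" by simp
  then have y: "(q ^ i * x * q) powr (p + 1) = X * r ^ (i + 1)"
    using powr_lattice[OF q(1) x, of "i + 1" p] unfolding X_def r_def
    by (metis mult.commute)
  have w: "x * q ^ i * (q ^ i * x) powr p = r ^ i * X"
    using powr_lattice[OF q(1) x, of i p] q x by (simp add: powr_add X_def r_def mult_ac)
  have z: "X * X powr (a - 1) = X powr a"
    using X by (simp add: powr_diff)
  have regroup: "x * (q ^ i * (w * y * (z * Q * c))) = (x * q ^ i * w) * z * (Q * c * y)"
    "r ^ i * X * z * (Q * c * y) = X * z * Q * (c * (r ^ i * y))"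
    for w y z Q c :: real by (simp_all only: mult_ac)
  show ?thesis
    unfolding qfrac_integrand_def y X_def[symmetric] r_def[symmetric] q_power_lattice(1)[OF r a X]
      regroup(1) w regroup(2) z ..
qed

text \<open>The constant \<open>q_power r (a - 1) 1 r\<close> from the kernel cancels against the
  normalisation of the integral, and the powers of 1 - q combine to exponent
  \<open>a\<close>.\<close>

lemma qfrac_integral_series:
  fixes p q a x :: real
  assumes q: "0 < q" "q < 1" and p: "0 < p" and a: "0 < a" "a < 1" and x: "0 < x"
  defines "r \<equiv> q powr (p + 1)"
  assumes ex: "qfrac_integral_exists p q a f x"
  shows "summable (\<lambda>i. r ^ i * f (q ^ i * x))"
    and "summable (\<lambda>i. q_binom r (r powr a) i * (r ^ i * f (q ^ i * x)))"
    and "qfrac_integral p q a f x = (1 - q) powr a * (x powr (p + 1)) powr a *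
      (\<Sum>i. q_binom r (r powr a) i * (r ^ i * f (q ^ i * x)))"
proof -
  note r = base_powr[OF q p, folded r_def]
  define K where "K = (x powr (p + 1)) powr a * q_power r (a - 1) 1 r"
  have Q: "0 < q_power r (a - 1) 1 r" by (rule q_power_lattice(2)[OF r a x])
  have K: "K \<noteq> 0" using Q x by (simp add: K_def)
  note lattice = qfrac_integrand_lattice[OF q p a x, of _ f, folded r_def, folded K_def]
  have sum: "summable (\<lambda>i. q ^ i * qfrac_integrand p q a f x (q ^ i * x))"
    using ex by (simp add: qfrac_integral_exists_def jackson_exists_def)
  from summable_mult[OF this, of x]
  have sum': "summable (\<lambda>i. q_binom r (r powr a) i * (r ^ i * f (q ^ i * x)))"
    unfolding lattice using K by simp
  then show "summable (\<lambda>i. q_binom r (r powr a) i * (r ^ i * f (q ^ i * x)))" .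
  then show "summable (\<lambda>i. r ^ i * f (q ^ i * x))"
    by (rule summable_cancel_q_binom[OF r powr_between_if_exponent_less_1[OF r a]])
  have "x * (\<Sum>i. q ^ i * qfrac_integrand p q a f x (q ^ i * x)) =
      K * (\<Sum>i. q_binom r (r powr a) i * (r ^ i * f (q ^ i * x)))"
    unfolding suminf_mult[OF sum, symmetric] suminf_mult[OF sum', symmetric] lattice ..
  then have "qfrac_integral p q a f x = ((1 - q) powr (a - 1) * (1 - q)) *
      (K * (\<Sum>i. q_binom r (r powr a) i * (r ^ i * f (q ^ i * x))) / q_power r (a - 1) 1 r)"
    unfolding qfrac_integral_def jackson_integral_def r_def[symmetric] by (simp add: mult.assoc)
  also have "(1 - q) powr (a - 1) * (1 - q) = (1 - q) powr a"
    using q by (simp add: powr_diff)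
  finally show "qfrac_integral p q a f x = (1 - q) powr a * (x powr (p + 1)) powr a *
      (\<Sum>i. q_binom r (r powr a) i * (r ^ i * f (q ^ i * x)))"
    using Q by (simp add: K_def)
qed

section \<open>Composition of complementary orders and recovery of the function\<close>

text \<open>The orders add up to 1: the right side is the series of the Jackson integral of w^p f(w)
  from 0 to x.\<close>

lemma qfrac_integral_complementary:
  fixes p q \<alpha> x :: real
  assumes q: "0 < q" "q < 1" and p: "0 < p" and \<alpha>: "0 < \<alpha>" "\<alpha> < 1" and x: "0 < x"
    and ex: "\<And>y. 0 < y \<Longrightarrow> qfrac_integral_exists p q \<alpha> f y"
    and ex': "qfrac_integral_exists p q (1 - \<alpha>) (qfrac_integral p q \<alpha> f) x"
  defines "r \<equiv> q powr (p + 1)"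
  shows "qfrac_integral p q (1 - \<alpha>) (qfrac_integral p q \<alpha> f) x =
    (1 - q) * x powr (p + 1) * (\<Sum>n. r ^ n * f (q ^ n * x))"
proof -
  note r = base_powr[OF q p, folded r_def]
  have \<alpha>': "0 < 1 - \<alpha>" "1 - \<alpha> < 1" using \<alpha> by auto
  define X where "X = x powr (p + 1)"
  have X: "0 < X" using x by (simp add: X_def)
  define A where "A = r powr \<alpha>"
  define B where "B = r powr (1 - \<alpha>)"
  note A = powr_between_if_exponent_less_1[OF r \<alpha>, folded A_def]
  note B = powr_between_if_exponent_less_1[OF r \<alpha>', folded B_def]
  define u where "u = (\<lambda>n. r ^ n * f (q ^ n * x))"
  define d where "d = (\<lambda>i. A ^ i * q_binom r B i)"
  define S where "S = (\<lambda>i. \<Sum>j. q_binom r A j * u (i + j))"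
  define C where "C = (1 - q) powr \<alpha> * X powr \<alpha>"
  have u: "summable u"
    unfolding u_def by (rule qfrac_integral_series(1)[OF q p \<alpha> x ex[OF x], folded r_def])
  \<comment> \<open>At the lattice point \<open>q ^ i * x\<close> the prefactor scales by
    \<open>A ^ i\<close>, and the outer weight \<open>r ^ i\<close> turns the inner terms into
    \<open>u (i + j)\<close>.\<close>
  have inner: "r ^ i * qfrac_integral p q \<alpha> f (q ^ i * x) = C * (A ^ i * S i)" for i
  proof -
    have y: "0 < q ^ i * x" using q x by simp
    have eq: "u (i + j) = r ^ i * (r ^ j * f (q ^ j * (q ^ i * x)))" for j
      by (simp add: u_def power_add mult_ac)
    have "(r ^ i * X) powr \<alpha> = A ^ i * X powr \<alpha>"
      using r X by (simp add: powr_mult A_def powr_realpow[symmetric] powr_powr mult.commute)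
    then have "((q ^ i * x) powr (p + 1)) powr \<alpha> = A ^ i * X powr \<alpha>"
      using powr_lattice[OF q(1) x, of i p] by (simp add: X_def r_def)
    moreover have "r ^ i * (\<Sum>j. q_binom r A j * (r ^ j * f (q ^ j * (q ^ i * x)))) = S i"
    proof -
      have "q_binom r A j * u (i + j) = r ^ i * (q_binom r A j * (r ^ j * f (q ^ j * (q ^ i * x))))" for j
        unfolding eq by (rule mult.left_commute)
      then show ?thesis
        using suminf_mult[OF qfrac_integral_series(2)[OF q p \<alpha> y ex[OF y], folded r_def, folded A_def],
            of "r ^ i"]
        by (simp only: S_def)
    qed
    ultimately show ?thesis
      unfolding qfrac_integral_series(3)[OF q p \<alpha> y ex[OF y], folded r_def, folded A_def] C_def
      by (simp add: mult_ac)
  qed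
  \<comment> \<open>The powers of A < 1 make \<open>d\<close> absolutely summable. The inner weights
    \<open>q_binom r A\<close> are only known to be bounded and monotone, so they take the role of
    \<open>c\<close> in the inversion of the convolution.\<close>
  have "summable (\<lambda>n. \<bar>d n\<bar>)"
  proof (rule summable_comparison_test')
    show "summable (\<lambda>n. A ^ n)" using A r by (intro summable_geometric) simp
    show "norm \<bar>d n\<bar> \<le> A ^ n" for n
      using q_binom_pos[OF r B, of n] q_binom_le_1[OF r B, of n] A r
      by (simp add: d_def abs_mult mult_left_le)
  qed
  moreover have "summable (\<lambda>n. \<bar>q_binom r A (Suc n) - q_binom r A n\<bar>)"
    using q_binom_pos[OF r A]
    by (intro summable_abs_diff_if_decseq[OF decseq_q_binom[OF r A], of 0]) (simp add: less_imp_le)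
  moreover have "(\<Sum>i\<le>n. d i * q_binom r A (n - i)) = 1" for n
  proof -
    have "A * B = r" using r by (simp add: A_def B_def powr_add[symmetric])
    then show ?thesis using q_Vandermonde[OF r, of A B n] q_binom_self[OF r] by (simp add: d_def)
  qed
  ultimately have dS: "(\<Sum>i. d i * S i) = suminf u"
    unfolding S_def using u by (intro suminf_convolution_inverse)
  have "C \<noteq> 0" using q X by (simp add: C_def)
  have dS_eq: "q_binom r B i * (r ^ i * qfrac_integral p q \<alpha> f (q ^ i * x)) = C * (d i * S i)" for i
    unfolding inner by (simp add: d_def mult_ac)
  \<comment> \<open>Existence of the outer integral gives this convergence, which is needed to pull
    \<open>C\<close> out of the sum.\<close>
  have "summable (\<lambda>i. C * (d i * S i))"
    using qfrac_integral_series(2)[OF q p \<alpha>' x ex', folded r_def, folded B_def] by (simp only: dS_eq)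
  then have "summable (\<lambda>i. d i * S i)" using \<open>C \<noteq> 0\<close> by simp
  then have "(\<Sum>i. q_binom r B i * (r ^ i * qfrac_integral p q \<alpha> f (q ^ i * x))) = C * suminf u"
    unfolding dS_eq by (simp add: suminf_mult dS)
  then have "qfrac_integral p q (1 - \<alpha>) (qfrac_integral p q \<alpha> f) x =
      (1 - q) powr (1 - \<alpha>) * X powr (1 - \<alpha>) * (C * suminf u)"
    using qfrac_integral_series(3)[OF q p \<alpha>' x ex', folded r_def, folded B_def X_def] by simp
  also have "\<dots> = ((1 - q) powr (1 - \<alpha>) * (1 - q) powr \<alpha>) * (X powr (1 - \<alpha>) * X powr \<alpha>) * suminf u"
    by (simp add: C_def mult_ac)
  also have "\<dots> = (1 - q) * X * suminf u"
    using q X by (simp flip: powr_add)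
  finally show ?thesis by (simp add: X_def u_def)
qed

theorem proposition11:
  fixes p q \<alpha> :: real and f :: "real \<Rightarrow> real"
  assumes "0 < q" and "q < 1" and "0 < \<alpha>" and "\<alpha> < 1" and "0 < p"
    and "\<And>y. 0 < y \<Longrightarrow> qfrac_integral_exists p q \<alpha> f y"
    and "\<And>y. 0 < y \<Longrightarrow>
      qfrac_integral_exists p q (real (qfrac_order \<alpha>) - \<alpha>) (qfrac_integral p q \<alpha> f) y"
  shows "\<forall>x>0. qfrac_derivative p q \<alpha> (qfrac_integral p q \<alpha> f) x = f x"
proof (intro allI impI)
  fix x :: real assume x: "0 < x"
  note q = assms(1,2) and \<alpha> = assms(3,4) and p = assms(5)
  define r where "r = q powr (p + 1)"
  define X where "X = x powr (p + 1)"
  define u where "u = (\<lambda>n. r ^ n * f (q ^ n * x))"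
  define H where "H = qfrac_integral p q (1 - \<alpha>) (qfrac_integral p q \<alpha> f)"
  have r: "0 < r" using base_powr[OF q p] by (simp add: r_def)
  \<comment> \<open>Since the floor of \<alpha> is 0, the derivative is a single q-difference of the
    integral \<open>H\<close> of order 1 - \<alpha>.\<close>
  have order: "qfrac_order \<alpha> = 1"
    using \<alpha> by (simp add: qfrac_order_def floor_eq_iff)
  have H: "H y = (1 - q) * y powr (p + 1) * (\<Sum>n. r ^ n * f (q ^ n * y))" if "0 < y" for y
    unfolding H_def r_def using assms(6,7) that order
    by (intro qfrac_integral_complementary[OF q p \<alpha>]) auto
  have u: "summable u"
    unfolding u_def r_def by (rule qfrac_integral_series(1)[OF q p \<alpha> x assms(6)[OF x]])
  \<comment> \<open>Passing from x to q x multiplies X by r and shifts the series by one place, so H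
    (q x) - H x retains only the first term \<open>f x\<close>.\<close>
  have "H (q * x) = (1 - q) * X * (r * (\<Sum>n. r ^ n * f (q ^ n * (q * x))))"
    using H[of "q * x"] q x powr_lattice[OF q(1) x, of 1 p] by (simp add: X_def r_def mult_ac)
  also have "r * (\<Sum>n. r ^ n * f (q ^ n * (q * x))) = (\<Sum>n. u (Suc n))"
  proof -
    have "u (Suc n) = r * (r ^ n * f (q ^ n * (q * x)))" for n
      by (simp add: u_def mult_ac)
    moreover have "summable (\<lambda>n. r ^ n * f (q ^ n * (q * x)))"
      using q x qfrac_integral_series(1)[OF q p \<alpha> _ assms(6), of "q * x"] by (simp add: r_def)
    ultimately show ?thesis by (simp add: suminf_mult)
  qed
  also have "\<dots> = suminf u - f x"
    using suminf_split_head[OF u] by (simp add: u_def)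
  finally have "H (q * x) - H x = (q - 1) * X * f x"
    using H[OF x] by (simp add: X_def u_def algebra_simps)
  moreover have "X = x powr p * x" using x by (simp add: X_def powr_add)
  ultimately have "x powr (- p) * q_derivative q H x = f x"
    using q x by (simp add: q_derivative_def powr_minus field_simps)
  then show "qfrac_derivative p q \<alpha> (qfrac_integral p q \<alpha> f) x = f x"
    by (simp add: qfrac_derivative_def order H_def)
qed

end
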